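(* Let $\{x^t\}_{t\ge 0}$ be the iterates of the multiplicative gradient (MG) method started from some $x^0\in\Delta_n$ with $x^0>0$ (entrywise). Then for any $x^*\in\mathcal{X}^*$ and all $t\ge 0$: (i) (non-ergodic rate) $f^* - f(x^t) \le \dfrac{D_{\rm KL}(x^*,x^0)}{t+1}$, and (ii) (ergodic rate) $f^* - f(\bar x^t) \le \dfrac{D_{\rm KL}(x^*,x^0)}{t+1}$, where $\bar x^t:=\frac{1}{t+1}\sum_{k=0}^t x^k$.
   Context: Let $m,n\ge 1$, $[n]=\{1,\dots,n\}$, and $\Delta_n=\{x\in\mathbb{R}^n: x\ge 0,\ \sum_{i=1}^n x_i=1\}$. Let $p_1,\dots,p_m>0$ with $\sum_{j=1}^m p_j=1$, and let $a_1,\dots,a_m\in\mathbb{R}^n$ be entrywise nonnegative and nonzero; $a_{ji}$ is the $i$-th entry of $a_j$. Let $f(x)=\sum_{j=1}^m p_j\ln(a_j^\top x)$ (with $\ln 0=-\infty$), $f^*=\max_{x\in\Delta_n} f(x)$, and let $\mathcal{X}^*\neq\emptyset$ be the set of maximizers of $f$ over $\Delta_n$. MG method: given $x^0\in\Delta_n$ with all entries positive, for $t\ge 0$ set $x_i^{t+1}=x_i^t\,\nabla_i f(x^t)$ for all $i\in[n]$, where $\nabla_i f(x)=\sum_{j=1}^m p_j\frac{a_{ji}}{a_j^\top x}$. (All iterates lie in $\Delta_n$ and satisfy $a_j^\top x^t>0$ for all $j$, so the method is well defined.) For $x,y\ge 0$, $D_{\rm KL}(y,x)=\sum_{i=1}^n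 y_i\ln(y_i/x_i)$, with conventions $0\ln 0=0$, $0\ln(0/0)=0$, and $a\ln(a/0)=+\infty$ for $a>0$. *)

theory Defs
  imports "HOL-Analysis.Analysis"
begin

text \<open>
  The dimensions \<open>n\<close> and \<open>m\<close> are the cardinalities of the finite index types \<open>'n\<close> and \<open>'m\<close>.
  The data are a weight vector \<open>p :: real^'m\<close> and a matrix \<open>a :: real^'n^'m\<close> whose
  \<open>j\<close>-th row \<open>a $ j\<close> is the vector \<open>a\<^sub>j\<close>, so that \<open>a $ j $ i\<close> is \<open>a\<^sub>j\<^sub>i\<close>.
\<close>

definition unit_simplex :: "(real^'n) set" where
  "unit_simplex = {x. (\<forall>i. 0 \<le> x $ i) \<and> (\<Sum>i\<in>UNIV. x $ i) = 1}"

text \<open>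
  Logarithm on nonnegative reals with \<open>ln 0 = -\<infinity>\<close>; it is never applied to a negative
  number on the simplex.
\<close>

definition eln :: "real \<Rightarrow> ereal" where
  "eln u = (if u = 0 then -\<infinity> else ereal (ln u))"

definition obj :: "real^'m \<Rightarrow> real^'n^'m \<Rightarrow> real^'n \<Rightarrow> ereal" where
  "obj p a x = (\<Sum>j\<in>UNIV. ereal (p $ j) * eln (a $ j \<bullet> x))"

definition maximizers :: "real^'m \<Rightarrow> real^'n^'m \<Rightarrow> (real^'n) set" where
  "maximizers p a = {x \<in> unit_simplex. \<forall>y\<in>unit_simplex. obj p a y \<le> obj p a x}"

text \<open>
  The supremum is a maximum as soon as \<open>maximizers p a\<close> is nonempty.
\<close>

definition opt_val :: "real^'m \<Rightarrow> real^'n^'m \<Rightarrow> ereal" where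
  "opt_val p a = (SUP x\<in>unit_simplex. obj p a x)"

lemma opt_val_attained:
  assumes "x \<in> maximizers p a"
  shows "opt_val p a = obj p a x"
  using assms unfolding maximizers_def opt_val_def
  by (auto intro!: antisym SUP_least SUP_upper)

definition obj_grad :: "real^'m \<Rightarrow> real^'n^'m \<Rightarrow> real^'n \<Rightarrow> real^'n" where
  "obj_grad p a x = (\<chi> i. \<Sum>j\<in>UNIV. p $ j * (a $ j $ i / (a $ j \<bullet> x)))"

primrec mg_iter :: "real^'m \<Rightarrow> real^'n^'m \<Rightarrow> real^'n \<Rightarrow> nat \<Rightarrow> real^'n" where
  "mg_iter p a x0 0 = x0"
| "mg_iter p a x0 (Suc t) =
     (\<chi> i. mg_iter p a x0 t $ i * obj_grad p a (mg_iter p a x0 t) $ i)"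

definition mg_avg :: "real^'m \<Rightarrow> real^'n^'m \<Rightarrow> real^'n \<Rightarrow> nat \<Rightarrow> real^'n" where
  "mg_avg p a x0 t = (1 / (real t + 1)) *\<^sub>R (\<Sum>k=0..t. mg_iter p a x0 k)"

text \<open>
  The case distinction encodes \<open>0 ln 0 = 0\<close>, \<open>0 ln (0/0) = 0\<close>, and
  \<open>c ln (c/0) = +\<infinity>\<close> for \<open>c > 0\<close>. No summand is \<open>-\<infinity>\<close>, so the sum is unambiguous.
\<close>

definition KL_div :: "real^'n \<Rightarrow> real^'n \<Rightarrow> ereal" where
  "KL_div y x = (\<Sum>i\<in>UNIV.
     if y $ i = 0 then 0
     else if x $ i = 0 then \<infinity>
     else ereal (y $ i * ln (y $ i / x $ i)))"

end

theory Submission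
  imports Defs
begin

text \<open>
  Let \<open>T\<close> be the map of one step of the method. Jensen's inequality gives
  \<open>f (T x) - f x \<ge> KL (T x, x)\<close>, so \<open>f\<close> increases along the iterates and every maximizer
  \<open>x\<^sup>*\<close> is a fixed point of \<open>T\<close>; that is, \<open>\<nabla>\<^sub>i f x\<^sup>* = 1\<close> whenever \<open>x\<^sup>*\<^sub>i > 0\<close>. Hence the
  numbers \<open>p\<^sub>j a\<^sub>j\<^sub>i / (a\<^sub>j \<bullet> x\<^sup>*)\<close> are weights summing to \<open>1\<close> over \<open>j\<close>, and Jensen's inequality
  with these weights, applied to
  \<open>\<nabla>\<^sub>i f x = (\<Sum>j. (p\<^sub>j a\<^sub>j\<^sub>i / (a\<^sub>j \<bullet> x\<^sup>*)) * ((a\<^sub>j \<bullet> x\<^sup>*) / (a\<^sub>j \<bullet> x)))\<close>, yields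
  \<open>f x\<^sup>* - f x \<le> (\<Sum>i. x\<^sup>*\<^sub>i ln (\<nabla>\<^sub>i f x)) = KL (x\<^sup>*, x) - KL (x\<^sup>*, T x)\<close>.
  This telescopes; monotonicity and concavity of \<open>f\<close> then give the two bounds.
\<close>

section \<open>Inequalities for the logarithm\<close>

text \<open>Jensen's inequality for \<open>ln\<close> with unnormalised weights. Positivity of
  \<open>r i\<close> is asked only where \<open>w i\<close> is positive, because the ratios of
  coordinates used later may degenerate to 0/0 where the weight vanishes.\<close>

lemma weighted_sum_ln_le:
  fixes w r :: "'i \<Rightarrow> real"
  assumes "finite A" and w: "\<And>i. i \<in> A \<Longrightarrow> 0 \<le> w i" and W: "0 < sum w A"
    and r: "\<And>i. i \<in> A \<Longrightarrow> 0 < w i \<Longrightarrow> 0 < r i"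
  shows "(\<Sum>i\<in>A. w i * ln (r i)) \<le> sum w A * ln ((\<Sum>i\<in>A. w i * r i) / sum w A)"
proof -
  define s where "s = (\<Sum>i\<in>A. w i * r i) / sum w A"
  have nn: "0 \<le> w i * r i" if "i \<in> A" for i
    using w[OF that] r[OF that] by (cases "w i = 0") auto
  obtain k where k: "k \<in> A" "0 < w k"
    using W by (metis not_le sum_nonpos)
  have "0 < (\<Sum>i\<in>A. w i * r i)"
    using sum_pos2[OF \<open>finite A\<close> k(1), of "\<lambda>i. w i * r i"] k r nn by auto
  then have s: "0 < s"
    using W by (simp add: s_def)
  \<comment> \<open>The tangent line of \<open>ln\<close> at the weighted mean \<open>s\<close> lies
    above \<open>ln\<close>; its linear part cancels on summation.\<close>
  have "w i * ln (r i) \<le> w i * ln s + (w i * r i / s - w i)" if "i \<in> A" for i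
  proof (cases "w i = 0")
    case False
    then have "0 < w i" "0 < r i"
      using w r that by force+
    moreover have "ln (r i / s) \<le> r i / s - 1"
      using \<open>0 < r i\<close> s by (intro ln_le_minus_one) simp
    ultimately have "w i * (ln (r i) - ln s) \<le> w i * (r i / s - 1)"
      using s by (intro mult_left_mono) (simp_all add: ln_div)
    then show ?thesis by (simp add: algebra_simps)
  qed simp
  then have "(\<Sum>i\<in>A. w i * ln (r i)) \<le> (\<Sum>i\<in>A. w i * ln s + (w i * r i / s - w i))"
    by (rule sum_mono)
  also have "\<dots> = sum w A * ln s + ((\<Sum>i\<in>A. w i * r i) / s - sum w A)"
    by (simp add: sum.distrib sum_subtractf sum_distrib_right sum_divide_distrib)
  also have "(\<Sum>i\<in>A. w i * r i) / s = sum w A"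
    using s W by (simp add: s_def field_simps)
  finally show ?thesis by (simp add: s_def)
qed

text \<open>This is ln u \<le> u - 1 at u = x / y. Summed over the coordinates of two simplex
  points, the left sides cancel, so KL is nonnegative.\<close>

lemma mult_ln_div_ge:
  fixes x y :: real
  assumes "0 \<le> x" "0 \<le> y" "0 < y \<Longrightarrow> 0 < x"
  shows "y - x \<le> y * ln (y / x)"
proof (cases "y = 0")
  case False
  then have pos: "0 < y" "0 < x" using assms by auto
  then have "y * ln (x / y) \<le> y * (x / y - 1)"
    by (intro mult_left_mono ln_le_minus_one) auto
  moreover have "y * (x / y - 1) = x - y" using pos by (simp add: field_simps)
  ultimately show ?thesis using pos by (simp add: ln_div algebra_simps)
qed (use assms in simp)

text \<open>The equality case: ln u = u - 1 only at u = 1.\<close>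

lemma mult_ln_div_le_imp_eq:
  fixes x y :: real
  assumes "0 \<le> x" "0 \<le> y" "0 < y \<Longrightarrow> 0 < x" "y * ln (y / x) \<le> y - x"
  shows "y = x"
proof (cases "y = 0")
  case False
  then have pos: "0 < y" "0 < x" using assms by auto
  have "y * (x / y - 1) = x - y" using pos by (simp add: field_simps)
  then have "y * (x / y - 1) \<le> y * ln (x / y)"
    using assms(4) pos by (simp add: ln_div algebra_simps)
  then have "x / y - 1 \<le> ln (x / y)" using pos by simp
  moreover have "ln (x / y) \<le> x / y - 1" using pos by (intro ln_le_minus_one) auto
  ultimately have "x / y = 1" using pos by (intro ln_eq_minus_one) auto
  then show ?thesis using pos by simp
qed (use assms in simp)

section \<open>Real-valued objective and its effective domain\<close>

lemma inner_vec_sum: "(u :: real^'n) \<bullet> v = (\<Sum>i\<in>UNIV. u $ i * v $ i)"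
  by (simp add: inner_vec_def)

definition robj :: "real^'m \<Rightarrow> real^'n^'m \<Rightarrow> real^'n \<Rightarrow> real" where
  "robj p a x = (\<Sum>j\<in>UNIV. p $ j * ln (a $ j \<bullet> x))"

definition mg_step :: "real^'m \<Rightarrow> real^'n^'m \<Rightarrow> real^'n \<Rightarrow> real^'n" where
  "mg_step p a x = (\<chi> i. x $ i * obj_grad p a x $ i)"

lemma mg_iter_Suc: "mg_iter p a x0 (Suc t) = mg_step p a (mg_iter p a x0 t)"
  by (simp add: mg_step_def)

text \<open>For positive weights this is the part of the simplex where f is finite; on it
  \<open>robj\<close> can replace the extended-real \<open>obj\<close>.\<close>

definition dom_simplex :: "real^'n^'m \<Rightarrow> (real^'n) set" where
  "dom_simplex a = {x \<in> unit_simplex. \<forall>j. 0 < a $ j \<bullet> x}"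

lemma dom_simplexD:
  assumes "x \<in> dom_simplex a"
  shows "0 \<le> x $ i" "(\<Sum>i\<in>UNIV. x $ i) = 1" "0 < a $ j \<bullet> x" "x \<in> unit_simplex"
  using assms by (auto simp: dom_simplex_def unit_simplex_def)

lemma obj_eq_robj:
  assumes "\<And>j. 0 < a $ j \<bullet> x"
  shows "obj p a x = ereal (robj p a x)"
proof -
  have "a $ j \<bullet> x \<noteq> 0" for j using assms[of j] by simp
  then show ?thesis by (simp add: obj_def robj_def eln_def)
qed

lemma obj_eq_MInf:
  fixes p :: "real^'m" and a :: "real^'n^'m"
  assumes p: "\<And>j. 0 < p $ j" and "a $ k \<bullet> x = 0"
  shows "obj p a x = -\<infinity>"
proof -
  \<comment> \<open>In \<open>ereal\<close>, \<infinity> + (-\<infinity>) = \<infinity>, so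
    \<infinity> must be excluded from the other summands before summand \<open>k\<close> decides the
    sum.\<close>
  have "(\<Sum>j\<in>UNIV - {k}. ereal (p $ j) * eln (a $ j \<bullet> x)) \<noteq> \<infinity>"
    using less_imp_le[OF p] by (simp add: sum_Pinfty eln_def not_less)
  moreover have "ereal (p $ k) * eln (a $ k \<bullet> x) = -\<infinity>"
    using assms(2) p[of k] by (simp add: eln_def)
  moreover have "obj p a x = ereal (p $ k) * eln (a $ k \<bullet> x)
      + (\<Sum>j\<in>UNIV - {k}. ereal (p $ j) * eln (a $ j \<bullet> x))"
    unfolding obj_def by (rule sum.remove) simp_all
  ultimately show ?thesis
    by (simp only: ereal_MInfty_eq_plus) simp
qed

section \<open>One step stays in the effective domain\<close>

locale mg =
  fixes p :: "real^'m" and a :: "real^'n^'m"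
  assumes p_pos: "0 < p $ j"
    and p_sum: "(\<Sum>j\<in>UNIV. p $ j) = 1"
    and a_nonneg: "0 \<le> a $ j $ i"
begin

text \<open>With \<open>c\<close> = x it gives conservation of mass; with c_i = x_i ln (y_i / x_i)
  it turns KL (T x, x) into an average over the rows.\<close>

lemma sum_mult_obj_grad:
  "(\<Sum>i\<in>UNIV. c i * obj_grad p a x $ i)
    = (\<Sum>j\<in>UNIV. p $ j * ((\<Sum>i\<in>UNIV. a $ j $ i * c i) / (a $ j \<bullet> x)))"
proof -
  have "(\<Sum>i\<in>UNIV. c i * obj_grad p a x $ i)
      = (\<Sum>i\<in>UNIV. \<Sum>j\<in>UNIV. c i * (p $ j * (a $ j $ i / (a $ j \<bullet> x))))"
    by (simp add: obj_grad_def sum_distrib_left)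
  also have "\<dots> = (\<Sum>j\<in>UNIV. \<Sum>i\<in>UNIV. c i * (p $ j * (a $ j $ i / (a $ j \<bullet> x))))"
    by (rule sum.swap)
  finally show ?thesis
    by (simp add: sum_distrib_left sum_divide_distrib mult_ac)
qed

lemma obj_grad_nonneg: "x \<in> dom_simplex a \<Longrightarrow> 0 \<le> obj_grad p a x $ i"
  unfolding obj_grad_def vec_lambda_beta
  by (intro sum_nonneg mult_nonneg_nonneg divide_nonneg_nonneg a_nonneg
      less_imp_le[OF p_pos] less_imp_le[OF dom_simplexD(3)])

lemma obj_grad_pos:
  assumes "x \<in> dom_simplex a" and "0 < a $ j $ i"
  shows "0 < obj_grad p a x $ i"
  unfolding obj_grad_def vec_lambda_beta
proof (rule sum_pos2[of _ j])
  show "0 < p $ j * (a $ j $ i / (a $ j \<bullet> x))"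
    using assms p_pos dom_simplexD(3)[OF assms(1)] by simp
  show "0 \<le> p $ k * (a $ k $ i / (a $ k \<bullet> x))" for k
    using p_pos a_nonneg dom_simplexD(3)[OF assms(1)] by (simp add: less_imp_le)
qed simp_all

text \<open>Whether the \<open>i\<close>-th partial derivative vanishes depends only on column
  \<open>i\<close> of \<open>a\<close>, not on the point.\<close>

lemma obj_grad_pos_transfer:
  assumes "x \<in> dom_simplex a" and "obj_grad p a y $ i \<noteq> 0"
  shows "0 < obj_grad p a x $ i"
proof -
  obtain j where "a $ j $ i \<noteq> 0"
    using assms(2) by (force simp: obj_grad_def)
  then show ?thesis
    using obj_grad_pos[OF assms(1)] a_nonneg[of j i] by (metis less_le)
qed

lemma pos_coordinate:
  assumes "x \<in> dom_simplex a"
  obtains i where "0 < a $ j $ i" "0 < x $ i"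
proof -
  have "\<exists>i. a $ j $ i * x $ i \<noteq> 0"
  proof (rule ccontr)
    assume "\<not> ?thesis"
    then have "a $ j \<bullet> x = 0" unfolding inner_vec_sum by (intro sum.neutral) blast
    then show False using dom_simplexD(3)[OF assms, of j] by simp
  qed
  then obtain i where "a $ j $ i \<noteq> 0" "x $ i \<noteq> 0"
    by auto
  then show ?thesis
    using that[of i] a_nonneg[of j i] dom_simplexD(1)[OF assms, of i] by simp
qed

lemma mg_step_pos:
  assumes "x \<in> dom_simplex a" "0 < a $ j $ i" "0 < x $ i"
  shows "0 < mg_step p a x $ i"
  using assms obj_grad_pos by (simp add: mg_step_def)

lemma mg_step_dom:
  assumes x: "x \<in> dom_simplex a"
  shows "mg_step p a x \<in> dom_simplex a"
proof -
  have nonneg: "0 \<le> mg_step p a x $ i" for i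
    using dom_simplexD(1)[OF x] obj_grad_nonneg[OF x] by (simp add: mg_step_def)
  have "a $ j \<bullet> x \<noteq> 0" for j
    using dom_simplexD(3)[OF x, of j] by simp
  then have "(\<Sum>i\<in>UNIV. mg_step p a x $ i) = (\<Sum>j\<in>UNIV. p $ j)"
    by (simp add: mg_step_def sum_mult_obj_grad flip: inner_vec_sum)
  moreover have "0 < a $ j \<bullet> mg_step p a x" for j
  proof -
    obtain i where i: "0 < a $ j $ i" "0 < x $ i"
      using pos_coordinate[OF x] .
    then show ?thesis
      using mg_step_pos[OF x i] nonneg a_nonneg unfolding inner_vec_sum
      by (intro sum_pos2[of _ i]) auto
  qed
  ultimately show ?thesis
    using nonneg p_sum by (simp add: dom_simplex_def unit_simplex_def)
qed

lemma mg_iter_dom: "x0 \<in> dom_simplex a \<Longrightarrow> mg_iter p a x0 t \<in> dom_simplex a"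
  by (induction t) (simp_all del: mg_iter.simps(2) add: mg_iter_Suc mg_step_dom)

section \<open>Ascent and fixed points\<close>

text \<open>For each row the weights a_ji x_i / (a_j \<bullet> x) sum to 1 over i, and the mean of
  y_i / x_i under them is (a_j \<bullet> y) / (a_j \<bullet> x). After Jensen, averaging over rows
  with p_j gives coordinate i the weight x_i \<nabla>_i f(x) = y_i.\<close>

lemma robj_mg_step_ge:
  assumes x: "x \<in> dom_simplex a"
  defines "y \<equiv> mg_step p a x"
  shows "(\<Sum>i\<in>UNIV. y $ i * ln (y $ i / x $ i)) \<le> robj p a y - robj p a x"
proof -
  have y: "y \<in> dom_simplex a"
    using mg_step_dom[OF x] by (simp add: y_def)
  have row: "(\<Sum>i\<in>UNIV. (a $ j $ i * x $ i / (a $ j \<bullet> x)) * ln (y $ i / x $ i))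
      \<le> ln (a $ j \<bullet> y) - ln (a $ j \<bullet> x)" for j
  proof -
    let ?w = "\<lambda>i. a $ j $ i * x $ i / (a $ j \<bullet> x)"
    have sw: "sum ?w UNIV = 1"
      using dom_simplexD(3)[OF x, of j] by (simp flip: sum_divide_distrib inner_vec_sum)
    have "0 \<le> ?w i" for i
      using a_nonneg dom_simplexD[OF x] by (simp add: less_imp_le)
    moreover have "0 < y $ i / x $ i" if "0 < ?w i" for i
    proof -
      have "a $ j $ i \<noteq> 0" "x $ i \<noteq> 0" using that by auto
      then have "0 < a $ j $ i" "0 < x $ i"
        using a_nonneg[of j i] dom_simplexD(1)[OF x, of i] by auto
      then show ?thesis using mg_step_pos[OF x] by (simp add: y_def)
    qed
    ultimately have "(\<Sum>i\<in>UNIV. ?w i * ln (y $ i / x $ i))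
        \<le> ln (\<Sum>i\<in>UNIV. ?w i * (y $ i / x $ i))"
      using weighted_sum_ln_le[of UNIV ?w "\<lambda>i. y $ i / x $ i"] sw by simp
    \<comment> \<open>Where \<open>x $ i = 0\<close>, also \<open>y $ i = 0\<close>, and both
      summands vanish.\<close>
    also have "(\<Sum>i\<in>UNIV. ?w i * (y $ i / x $ i)) = (\<Sum>i\<in>UNIV. a $ j $ i * y $ i / (a $ j \<bullet> x))"
      by (rule sum.cong) (auto simp: y_def mg_step_def)
    also have "\<dots> = (a $ j \<bullet> y) / (a $ j \<bullet> x)"
      by (simp add: inner_vec_sum sum_divide_distrib)
    finally show ?thesis
      using dom_simplexD(3)[OF x, of j] dom_simplexD(3)[OF y, of j] by (simp add: ln_div)
  qed
  have "(\<Sum>i\<in>UNIV. y $ i * ln (y $ i / x $ i))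
      = (\<Sum>i\<in>UNIV. (x $ i * ln (y $ i / x $ i)) * obj_grad p a x $ i)"
    by (simp add: y_def mg_step_def mult_ac)
  also have "\<dots> = (\<Sum>j\<in>UNIV. p $ j *
      (\<Sum>i\<in>UNIV. (a $ j $ i * x $ i / (a $ j \<bullet> x)) * ln (y $ i / x $ i)))"
    unfolding sum_mult_obj_grad by (simp add: sum_divide_distrib mult_ac)
  also have "\<dots> \<le> (\<Sum>j\<in>UNIV. p $ j * (ln (a $ j \<bullet> y) - ln (a $ j \<bullet> x)))"
    using row p_pos by (intro sum_mono mult_left_mono) (auto simp: less_imp_le)
  finally show ?thesis
    by (simp add: robj_def right_diff_distrib sum_subtractf)
qed

lemma mg_step_pos_imp_pos:
  assumes "x \<in> dom_simplex a" "0 < mg_step p a x $ i"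
  shows "0 < x $ i"
  using assms dom_simplexD(1)[OF assms(1), of i]
  by (cases "x $ i = 0") (auto simp: mg_step_def)

lemma robj_mg_step_mono:
  assumes x: "x \<in> dom_simplex a"
  shows "robj p a x \<le> robj p a (mg_step p a x)"
proof -
  let ?y = "mg_step p a x"
  note y = mg_step_dom[OF x]
  have "(\<Sum>i\<in>UNIV. ?y $ i - x $ i) \<le> (\<Sum>i\<in>UNIV. ?y $ i * ln (?y $ i / x $ i))"
    using mg_step_pos_imp_pos[OF x] dom_simplexD(1)[OF x] dom_simplexD(1)[OF y]
    by (intro sum_mono mult_ln_div_ge)
  then show ?thesis
    using robj_mg_step_ge[OF x] by (simp add: sum_subtractf dom_simplexD(2)[OF x] dom_simplexD(2)[OF y])
qed

lemma mg_step_fixed: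
  assumes x: "x \<in> dom_simplex a" and le: "robj p a (mg_step p a x) \<le> robj p a x"
  shows "mg_step p a x = x"
proof -
  let ?y = "mg_step p a x"
  \<comment> \<open>Unlike the plain KL summand, \<open>?d i\<close> is nonnegative for each
    \<open>i\<close>, and the subtracted terms sum to 0; a total of at most 0 thus kills every
    \<open>?d i\<close>.\<close>
  let ?d = "\<lambda>i. ?y $ i * ln (?y $ i / x $ i) - (?y $ i - x $ i)"
  note y = mg_step_dom[OF x]
  note nonneg = dom_simplexD(1)[OF x] dom_simplexD(1)[OF y]
  have ge: "0 \<le> ?d i" for i
    using mult_ln_div_ge[OF nonneg mg_step_pos_imp_pos[OF x]] by simp
  have "sum ?d UNIV \<le> 0"
    using robj_mg_step_ge[OF x] le
    by (simp add: sum_subtractf dom_simplexD(2)[OF x] dom_simplexD(2)[OF y])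
  then have "sum ?d UNIV = 0"
    using ge by (intro antisym sum_nonneg) auto
  then have "?d i = 0" for i
    using ge by (simp add: sum_nonneg_eq_0_iff)
  then have "?y $ i = x $ i" for i
    using mult_ln_div_le_imp_eq[OF nonneg mg_step_pos_imp_pos[OF x], of i] by simp
  then show ?thesis by (simp add: vec_eq_iff)
qed

section \<open>Gap bound and telescoping\<close>

lemma robj_gap_le:
  assumes xs: "xs \<in> dom_simplex a" and fp: "mg_step p a xs = xs" and x: "x \<in> dom_simplex a"
  shows "robj p a xs - robj p a x \<le> (\<Sum>i\<in>UNIV. xs $ i * ln (obj_grad p a x $ i))"
proof -
  let ?r = "\<lambda>j. (a $ j \<bullet> xs) / (a $ j \<bullet> x)"
  let ?w = "\<lambda>i j. p $ j * (a $ j $ i / (a $ j \<bullet> xs))"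
  have r_pos: "0 < ?r j" for j
    using dom_simplexD(3)[OF xs, of j] dom_simplexD(3)[OF x, of j] by simp
  have col: "(\<Sum>j\<in>UNIV. ?w i j * ln (?r j)) \<le> ln (obj_grad p a x $ i)" if "xs $ i \<noteq> 0" for i
  proof -
    have "xs $ i * obj_grad p a xs $ i = xs $ i"
      using fp by (metis mg_step_def vec_lambda_beta)
    then have sw: "sum (?w i) UNIV = 1"
      using that by (simp add: obj_grad_def)
    have "(\<Sum>j\<in>UNIV. ?w i j * ln (?r j)) \<le> ln (\<Sum>j\<in>UNIV. ?w i j * ?r j)"
      using weighted_sum_ln_le[of UNIV "?w i" ?r] sw r_pos p_pos a_nonneg dom_simplexD(3)[OF xs]
      by (simp add: less_imp_le)
    also have "(\<Sum>j\<in>UNIV. ?w i j * ?r j) = obj_grad p a x $ i"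
      unfolding obj_grad_def vec_lambda_beta
    proof (rule sum.cong)
      fix j
      show "?w i j * ?r j = p $ j * (a $ j $ i / (a $ j \<bullet> x))"
        using dom_simplexD(3)[OF xs, of j] by simp
    qed simp
    finally show ?thesis .
  qed
  have "robj p a xs - robj p a x = (\<Sum>j\<in>UNIV. p $ j * ln (?r j))"
    unfolding robj_def sum_subtractf[symmetric] right_diff_distrib[symmetric]
  proof (rule sum.cong)
    fix j
    show "p $ j * (ln (a $ j \<bullet> xs) - ln (a $ j \<bullet> x)) = p $ j * ln (?r j)"
      using dom_simplexD(3)[OF xs, of j] dom_simplexD(3)[OF x, of j] by (simp add: ln_div)
  qed simp
  \<comment> \<open>The joint weights \<open>xs $ i * ?w i j\<close> have marginal
    \<open>p $ j\<close> by cancellation of \<open>a $ j \<bullet> xs\<close>, and marginal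
    \<open>xs $ i\<close> by the fixed-point equation.\<close>
  also have "\<dots> = (\<Sum>j\<in>UNIV. \<Sum>i\<in>UNIV. xs $ i * (?w i j * ln (?r j)))"
  proof (rule sum.cong)
    fix j
    have "(\<Sum>i\<in>UNIV. xs $ i * (?w i j * ln (?r j)))
        = (\<Sum>i\<in>UNIV. (p $ j * ln (?r j) / (a $ j \<bullet> xs)) * (a $ j $ i * xs $ i))"
      by (simp add: mult_ac)
    also have "\<dots> = (p $ j * ln (?r j) / (a $ j \<bullet> xs)) * (a $ j \<bullet> xs)"
      by (simp only: inner_vec_sum[of "a $ j" xs] sum_distrib_left)
    finally have "(\<Sum>i\<in>UNIV. xs $ i * (?w i j * ln (?r j)))
        = (p $ j * ln (?r j) / (a $ j \<bullet> xs)) * (a $ j \<bullet> xs)" .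
    then show "p $ j * ln (?r j) = (\<Sum>i\<in>UNIV. xs $ i * (?w i j * ln (?r j)))"
      using dom_simplexD(3)[OF xs, of j] by simp
  qed simp
  also have "\<dots> = (\<Sum>i\<in>UNIV. xs $ i * (\<Sum>j\<in>UNIV. ?w i j * ln (?r j)))"
    by (subst sum.swap) (simp add: sum_distrib_left)
  also have "\<dots> \<le> (\<Sum>i\<in>UNIV. xs $ i * ln (obj_grad p a x $ i))"
  proof (rule sum_mono)
    fix i
    show "xs $ i * (\<Sum>j\<in>UNIV. ?w i j * ln (?r j)) \<le> xs $ i * ln (obj_grad p a x $ i)"
      using col[of i] dom_simplexD(1)[OF xs, of i]
      by (cases "xs $ i = 0") (auto intro: mult_left_mono)
  qed
  finally show ?thesis .
qed

lemma sum_robj_gap_le: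
  assumes xs: "xs \<in> dom_simplex a" and fp: "mg_step p a xs = xs"
    and x0: "x0 \<in> dom_simplex a" and x0_pos: "\<And>i. 0 < x0 $ i"
  shows "(\<Sum>k=0..t. robj p a xs - robj p a (mg_iter p a x0 k))
    \<le> (\<Sum>i\<in>UNIV. xs $ i * ln (xs $ i / x0 $ i))"
proof -
  let ?x = "mg_iter p a x0"
  \<comment> \<open>Up to the constant \<Sum> xs_i ln xs_i, this is -KL (xs, x^t), written without a
    quotient.\<close>
  let ?\<Phi> = "\<lambda>t. \<Sum>i\<in>UNIV. xs $ i * ln (?x t $ i)"
  have grad_pos: "0 < obj_grad p a (?x t) $ i" if "xs $ i \<noteq> 0" for i t
  proof -
    have "xs $ i * obj_grad p a xs $ i = xs $ i"
      using fp by (metis mg_step_def vec_lambda_beta)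
    then show ?thesis
      using obj_grad_pos_transfer[OF mg_iter_dom[OF x0]] that by (metis mult_zero_right)
  qed
  \<comment> \<open>Iterates may lose coordinates whose column of \<open>a\<close> is zero, but none
    in the support of \<open>xs\<close>.\<close>
  have pos: "0 < ?x t $ i" if "xs $ i \<noteq> 0" for i t
    using grad_pos[OF that] by (induction t) (simp_all add: x0_pos)
  have step: "robj p a xs - robj p a (?x t) \<le> ?\<Phi> (Suc t) - ?\<Phi> t" for t
  proof -
    have "xs $ i * ln (?x (Suc t) $ i) - xs $ i * ln (?x t $ i)
        = xs $ i * ln (obj_grad p a (?x t) $ i)" for i
      using pos[of i t] grad_pos[of i t]
      by (cases "xs $ i = 0") (simp_all add: ln_mult algebra_simps)
    then have "?\<Phi> (Suc t) - ?\<Phi> t = (\<Sum>i\<in>UNIV. xs $ i * ln (obj_grad p a (?x t) $ i))"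
      by (simp only: sum_subtractf[symmetric])
    then show ?thesis
      using robj_gap_le[OF xs fp mg_iter_dom[OF x0]] by simp
  qed
  have "(\<Sum>k=0..t. robj p a xs - robj p a (?x k)) \<le> ?\<Phi> (Suc t) - ?\<Phi> 0"
  proof (induction t)
    case 0
    then show ?case using step[of 0] by simp
  next
    case (Suc t)
    then show ?case using step[of "Suc t"] by (simp del: mg_iter.simps)
  qed
  also have "\<dots> \<le> (\<Sum>i\<in>UNIV. xs $ i * ln (xs $ i / x0 $ i))"
  proof -
    \<comment> \<open>Dropping KL (xs, x^(t+1)) \<ge> 0, done termwise; the added differences sum to
      0 over the simplex.\<close>
    have "xs $ i * ln (?x (Suc t) $ i) - xs $ i * ln (?x 0 $ i) + (xs $ i - ?x (Suc t) $ i)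
        \<le> xs $ i * ln (xs $ i / x0 $ i)" for i
    proof (cases "xs $ i = 0")
      case True
      then show ?thesis
        using dom_simplexD(1)[OF mg_iter_dom[OF x0], of "Suc t" i] by (simp del: mg_iter.simps)
    next
      case False
      then have "0 < xs $ i"
        using dom_simplexD(1)[OF xs, of i] by simp
      moreover have "xs $ i - ?x (Suc t) $ i \<le> xs $ i * ln (xs $ i / ?x (Suc t) $ i)"
        using \<open>0 < xs $ i\<close> pos[OF False, of "Suc t"] by (intro mult_ln_div_ge) auto
      ultimately show ?thesis
        using pos[OF False, of "Suc t"] x0_pos[of i]
        by (simp add: ln_div algebra_simps del: mg_iter.simps(2))
    qed
    then have "(\<Sum>i\<in>UNIV. xs $ i * ln (?x (Suc t) $ i) - xs $ i * ln (?x 0 $ i)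
          + (xs $ i - ?x (Suc t) $ i))
        \<le> (\<Sum>i\<in>UNIV. xs $ i * ln (xs $ i / x0 $ i))"
      by (intro sum_mono)
    then show ?thesis
      using dom_simplexD(2)[OF xs] dom_simplexD(2)[OF mg_iter_dom[OF x0, of "Suc t"]]
      by (simp add: sum.distrib sum_subtractf del: mg_iter.simps)
  qed
  finally show ?thesis .
qed

section \<open>Last iterate, average and maximizers\<close>

lemma robj_mg_iter_mono:
  assumes "x0 \<in> dom_simplex a" and "k \<le> t"
  shows "robj p a (mg_iter p a x0 k) \<le> robj p a (mg_iter p a x0 t)"
  using assms(2)
proof (induction t rule: dec_induct)
  case (step t)
  then show ?case
    using robj_mg_step_mono[OF mg_iter_dom[OF assms(1)], of t]
    by (simp del: mg_iter.simps add: mg_iter_Suc)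
qed simp

lemma inner_mg_avg:
  "a $ j \<bullet> mg_avg p a x0 t = (\<Sum>k=0..t. a $ j \<bullet> mg_iter p a x0 k) / (real t + 1)"
  by (simp add: mg_avg_def inner_sum_right)

lemma inner_mg_avg_pos:
  assumes "x0 \<in> dom_simplex a"
  shows "0 < a $ j \<bullet> mg_avg p a x0 t"
  unfolding inner_mg_avg using dom_simplexD(3)[OF mg_iter_dom[OF assms]]
  by (intro divide_pos_pos sum_pos) auto

text \<open>Concavity of f, obtained row by row from Jensen with t + 1 unit weights.\<close>

lemma sum_robj_le_robj_mg_avg:
  assumes "x0 \<in> dom_simplex a"
  shows "(\<Sum>k=0..t. robj p a (mg_iter p a x0 k)) \<le> (real t + 1) * robj p a (mg_avg p a x0 t)"
proof -
  have "(\<Sum>k=0..t. ln (a $ j \<bullet> mg_iter p a x0 k)) \<le> (real t + 1) * ln (a $ j \<bullet> mg_avg p a x0 t)" for j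
    using weighted_sum_ln_le[of "{0..t}" "\<lambda>_. 1" "\<lambda>k. a $ j \<bullet> mg_iter p a x0 k"]
      dom_simplexD(3)[OF mg_iter_dom[OF assms]]
    by (simp add: inner_mg_avg add.commute)
  then have "(\<Sum>j\<in>UNIV. p $ j * (\<Sum>k=0..t. ln (a $ j \<bullet> mg_iter p a x0 k)))
      \<le> (\<Sum>j\<in>UNIV. p $ j * ((real t + 1) * ln (a $ j \<bullet> mg_avg p a x0 t)))"
    using p_pos by (intro sum_mono mult_left_mono) (auto simp: less_imp_le)
  moreover have "(\<Sum>k=0..t. robj p a (mg_iter p a x0 k))
      = (\<Sum>j\<in>UNIV. p $ j * (\<Sum>k=0..t. ln (a $ j \<bullet> mg_iter p a x0 k)))"
    unfolding robj_def by (subst sum.swap) (simp add: sum_distrib_left)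
  ultimately show ?thesis
    by (simp add: robj_def sum_distrib_left mult_ac)
qed

text \<open>Comparison with \<open>x0\<close>, where f is finite, rules out the value
  -\<infinity>.\<close>

lemma maximizer_dom:
  assumes "xs \<in> maximizers p a" and "x0 \<in> dom_simplex a"
  shows "xs \<in> dom_simplex a"
proof -
  have xs: "xs \<in> unit_simplex" and "obj p a x0 \<le> obj p a xs"
    using assms by (auto simp: maximizers_def dom_simplexD)
  then have "obj p a xs \<noteq> -\<infinity>"
    using obj_eq_robj[OF dom_simplexD(3)[OF assms(2)]] by auto
  then have "a $ j \<bullet> xs \<noteq> 0" for j
    using obj_eq_MInf p_pos by blast
  moreover have "0 \<le> a $ j \<bullet> xs" for j
    unfolding inner_vec_sum using xs a_nonneg
    by (intro sum_nonneg) (auto simp: unit_simplex_def)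
  ultimately show ?thesis
    using xs by (simp add: dom_simplex_def less_le)
qed

lemma maximizer_fixed:
  assumes "xs \<in> maximizers p a" and "xs \<in> dom_simplex a"
  shows "mg_step p a xs = xs"
proof (rule mg_step_fixed[OF assms(2)])
  note y = mg_step_dom[OF assms(2)]
  have "obj p a (mg_step p a xs) \<le> obj p a xs"
    using assms(1) dom_simplexD(4)[OF y] by (simp add: maximizers_def)
  then show "robj p a (mg_step p a xs) \<le> robj p a xs"
    by (simp add: obj_eq_robj dom_simplexD(3)[OF y] dom_simplexD(3)[OF assms(2)])
qed

end

text \<open>The \<infinity> branch cannot occur, and for \<open>y $ i = 0\<close> the factor 0
  reproduces the convention 0 ln 0 = 0.\<close>

lemma KL_div_eq_ereal:
  assumes "\<And>i. 0 < x $ i"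
  shows "KL_div y x = ereal (\<Sum>i\<in>UNIV. y $ i * ln (y $ i / x $ i))"
proof -
  have "x $ i \<noteq> 0" for i
    using assms[of i] by simp
  then have "KL_div y x = (\<Sum>i\<in>UNIV. ereal (y $ i * ln (y $ i / x $ i)))"
    unfolding KL_div_def by (intro sum.cong) auto
  then show ?thesis by simp
qed

theorem theorem1:
  fixes p :: "real^'m" and a :: "real^'n^'m" and x0 xs :: "real^'n" and t :: nat
  assumes "\<forall>j. 0 < p $ j"
    and "(\<Sum>j\<in>UNIV. p $ j) = 1"
    and "\<forall>j i. 0 \<le> a $ j $ i"
    and "\<forall>j. a $ j \<noteq> 0"
    and "x0 \<in> unit_simplex"
    and "\<forall>i. 0 < x0 $ i"
    and "xs \<in> maximizers p a"
  shows "opt_val p a - obj p a (mg_iter p a x0 t) \<le> KL_div xs x0 / ereal (real t + 1) \<and>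
         opt_val p a - obj p a (mg_avg p a x0 t) \<le> KL_div xs x0 / ereal (real t + 1)"
proof -
  interpret mg p a
    using assms by unfold_locales auto
  have "0 < a $ j \<bullet> x0" for j
  proof -
    obtain i where "a $ j $ i \<noteq> 0"
      using assms(4) by (metis vec_eq_iff zero_index)
    then have "0 < a $ j $ i * x0 $ i"
      using assms(3,6) by (simp add: less_le)
    then show ?thesis
      unfolding inner_vec_sum using assms(3,6)
      by (intro sum_pos2[of _ i]) (auto simp: less_imp_le)
  qed
  then have x0: "x0 \<in> dom_simplex a"
    using assms(5) by (simp add: dom_simplex_def)
  note xs = maximizer_dom[OF assms(7) x0]
  define D where "D = (\<Sum>i\<in>UNIV. xs $ i * ln (xs $ i / x0 $ i))"
  let ?f = "robj p a" and ?x = "mg_iter p a x0"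
  have "(real t + 1) * ?f xs - (\<Sum>k=0..t. ?f (?x k)) \<le> D"
    using sum_robj_gap_le[OF xs maximizer_fixed[OF assms(7) xs] x0, of t] assms(6)
    by (simp add: D_def sum_subtractf algebra_simps)
  \<comment> \<open>By monotonicity the last gap is the smallest, so t + 1 copies of it are at most
    the telescoped sum.\<close>
  moreover have "(\<Sum>k=0..t. ?f (?x k)) \<le> (\<Sum>k=0..t. ?f (?x t))"
    using robj_mg_iter_mono[OF x0] by (intro sum_mono) auto
  moreover note sum_robj_le_robj_mg_avg[OF x0, of t]
  ultimately have "(?f xs - ?f (?x t)) * (real t + 1) \<le> D"
      "(?f xs - ?f (mg_avg p a x0 t)) * (real t + 1) \<le> D"
    by (simp_all add: algebra_simps)
  then have "?f xs - ?f (?x t) \<le> D / (real t + 1)"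
      "?f xs - ?f (mg_avg p a x0 t) \<le> D / (real t + 1)"
    by (simp_all add: pos_le_divide_eq)
  moreover have "KL_div xs x0 / ereal (real t + 1) = ereal (D / (real t + 1))"
    using assms(6) by (simp add: KL_div_eq_ereal D_def)
  ultimately show ?thesis
    by (simp add: opt_val_attained[OF assms(7)] obj_eq_robj dom_simplexD(3)[OF xs]
        dom_simplexD(3)[OF mg_iter_dom[OF x0]] inner_mg_avg_pos[OF x0])
qed

end
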